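(* Any public bads allocation rule $\phi$ that satisfies the axioms of cost consistency, weak symmetry, scale-freeness, and lower contraction consistency must return a superset of the strictly positive proportionally fair lotteries for every instance; that is, for every public bads instance $I$, every strictly positive proportionally fair lottery of $I$ belongs to $\phi(I)$.
   Context: A public bads instance $I=(N,A,c)$ consists of agents $N=\{1,\dots,n\}$, a finite set $A$ of alternatives (bads), and cost functions $c_i:A\to\mathbb{R}_{\ge 0}$, $i\in N$. $\Delta(A)$ is the set of lotteries (probability vectors) on $A$; $c_i(x)=\sum_{a\in A}x(a)c_i(a)$ and $c(x)=(c_i(x))_{i\in N}$. Write $\mathcal{C}(I)=\{c(x):x\in\Delta(A)\}$ and $\mathcal{C}_{\ge}(I)=\{z\in\mathbb{R}^N_{\ge0}:\exists z'\in\mathcal{C}(I)\text{ with }z\ge z'\text{ coordinatewise}\}$. Standing assumptions on instances: $0\notin\mathcal{C}(I)$, and for every $i\in N$ there is $a\in A$ with $c_i(a)<\max_{a'\in A}c_i(a')$. $x\in\Delta(A)$ is proportionally fair if $\frac1n\sum_{i\in N}\frac{c_i(y)}{c_i(x)}\ge 1$ for all $y\in\Delta(A)$ (conventions $0/0=1$, $\alpha/0=+\infty$ for $\alpha>0$), and strictly positive if $c_i(x)>0$ for all $i\in N$. A public bads allocation rule $\phi$ maps each instance $I=(N,A,c)$ to a possibly empty set $\phi(I)\subseteq\Delta(A)$; write $c(\phi(I))=\{c(x):x\in\phi(I)\}$. Cost consistency: for any instance $I$ and any lotteries $x,x'$ over $I$ with $c_i(x)=c_i(x')$ for all $i\in N$: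 $x\in\phi(I)$ if and only if $x'\in\phi(I)$. Weak symmetry: an identity instance is an instance with $n$ agents and $n$ bads in which for each agent $i\in N$ there exists a unique bad $a_i\in A$ such that $c_i(a_i)=1$ and $c_{i'}(a_i)=0$ for all $i'\ne i$. $\phi$ is weakly symmetric if for any identity instance it returns a single allocation, the allocation which places weight $1/n$ on each bad. Scale-freeness: for any two instances $I=(N,A,c)$ and $I'=(N,A,c')$ such that for some agent $i\in N$ there is a constant $k>0$ with $c'_i(a)=k\,c_i(a)$ for all $a\in A$, and $c'_{i'}(a)=c_{i'}(a)$ for all $i'\neq i$ and $a\in A$: $\phi(I)=\phi(I')$. Lower contraction consistency: for any pair of instances $I=(N,A,c)$ and $I'=(N,A',c')$ with $\mathcal{C}_{\ge}(I)\subseteq\mathcal{C}_{\ge}(I')$, we have $c'(\phi(I'))\cap\mathcal{C}(I)\subseteq c(\phi(I))$.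
   Formalization: The claim is proved for instances with at least two agents; with one agent it fails, since the one-agent identity instance violates the standing assumption that some bad costs less than the maximum, so weak symmetry is vacuous and the rule may return the empty set. *)

theory Defs
  imports "HOL-Probability.Probability"
begin

record 'a bads_instance =
  num_agents :: nat
  bads :: "'a set"
  cost :: "nat \<Rightarrow> 'a \<Rightarrow> real"

definition agents :: "'a bads_instance \<Rightarrow> nat set" where
  "agents I = {1..num_agents I}"

text \<open>Lotteries over the finite set \<open>A\<close> are the probability mass functions supported in \<open>A\<close>.
  Vectors indexed by the agents are extensional functions on \<open>agents I\<close>, so that equality and
  membership are those of real vectors of length \<open>num_agents I\<close>.\<close>

definition lotteries :: "'a bads_instance \<Rightarrow> 'a pmf set" where
  "lotteries I = {x. set_pmf x \<subseteq> bads I}"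

definition lottery_cost :: "'a bads_instance \<Rightarrow> nat \<Rightarrow> 'a pmf \<Rightarrow> real" where
  "lottery_cost I i x = (\<Sum>a\<in>bads I. pmf x a * cost I i a)"

definition cost_vector :: "'a bads_instance \<Rightarrow> 'a pmf \<Rightarrow> nat \<Rightarrow> real" where
  "cost_vector I x = (\<lambda>i\<in>agents I. lottery_cost I i x)"

definition cost_set :: "'a bads_instance \<Rightarrow> (nat \<Rightarrow> real) set" where
  "cost_set I = cost_vector I ` lotteries I"

definition upper_cost_set :: "'a bads_instance \<Rightarrow> (nat \<Rightarrow> real) set" where
  "upper_cost_set I =
     {z \<in> agents I \<rightarrow>\<^sub>E {0..}. \<exists>z'\<in>cost_set I. \<forall>i\<in>agents I. z' i \<le> z i}"

text \<open>The last two conjuncts are the standing assumptions. Costs are extensional, so that an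
  instance is determined by its agents, its bads and its costs on them. The case of no agents is
  excluded because the zero vector is then the only cost vector.\<close>

definition valid_instance :: "'a bads_instance \<Rightarrow> bool" where
  "valid_instance I \<longleftrightarrow>
     finite (bads I) \<and> bads I \<noteq> {} \<and>
     cost I \<in> agents I \<rightarrow>\<^sub>E (bads I \<rightarrow>\<^sub>E {0..}) \<and>
     (\<lambda>i\<in>agents I. 0) \<notin> cost_set I \<and>
     (\<forall>i\<in>agents I. \<exists>a\<in>bads I. cost I i a < Max (cost I i ` bads I))"

definition cost_ratio :: "real \<Rightarrow> real \<Rightarrow> ereal" where
  "cost_ratio a b = (if b = 0 then (if a = 0 then 1 else \<infinity>) else ereal (a / b))"

definition proportionally_fair :: "'a bads_instance \<Rightarrow> 'a pmf \<Rightarrow> bool" where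
  "proportionally_fair I x \<longleftrightarrow> x \<in> lotteries I \<and>
     (\<forall>y\<in>lotteries I.
        ereal (1 / real (num_agents I)) *
          (\<Sum>i\<in>agents I. cost_ratio (lottery_cost I i y) (lottery_cost I i x)) \<ge> 1)"

definition strictly_positive :: "'a bads_instance \<Rightarrow> 'a pmf \<Rightarrow> bool" where
  "strictly_positive I x \<longleftrightarrow> (\<forall>i\<in>agents I. lottery_cost I i x > 0)"

definition allocation_rule :: "('a bads_instance \<Rightarrow> 'a pmf set) \<Rightarrow> bool" where
  "allocation_rule \<phi> \<longleftrightarrow> (\<forall>I. valid_instance I \<longrightarrow> \<phi> I \<subseteq> lotteries I)"

definition cost_consistent :: "('a bads_instance \<Rightarrow> 'a pmf set) \<Rightarrow> bool" where
  "cost_consistent \<phi> \<longleftrightarrow>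
     (\<forall>I x x'. valid_instance I \<and> x \<in> lotteries I \<and> x' \<in> lotteries I \<and>
        (\<forall>i\<in>agents I. lottery_cost I i x = lottery_cost I i x') \<longrightarrow>
        (x \<in> \<phi> I \<longleftrightarrow> x' \<in> \<phi> I))"

text \<open>For a single agent the only identity instance has one bad, of cost 1, which violates the
  second standing assumption. Hence weak symmetry only restricts a rule when there are at least
  two agents.\<close>

definition identity_instance :: "'a bads_instance \<Rightarrow> bool" where
  "identity_instance I \<longleftrightarrow> valid_instance I \<and> card (bads I) = num_agents I \<and>
     (\<forall>i\<in>agents I. \<exists>!a. a \<in> bads I \<and> cost I i a = 1 \<and>
        (\<forall>i'\<in>agents I. i' \<noteq> i \<longrightarrow> cost I i' a = 0))"

definition weakly_symmetric :: "('a bads_instance \<Rightarrow> 'a pmf set) \<Rightarrow> bool" where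
  "weakly_symmetric \<phi> \<longleftrightarrow> (\<forall>I. identity_instance I \<longrightarrow> \<phi> I = {pmf_of_set (bads I)})"

definition scale_free :: "('a bads_instance \<Rightarrow> 'a pmf set) \<Rightarrow> bool" where
  "scale_free \<phi> \<longleftrightarrow>
     (\<forall>I I'. valid_instance I \<and> valid_instance I' \<and>
        num_agents I' = num_agents I \<and> bads I' = bads I \<and>
        (\<exists>i\<in>agents I.
           (\<exists>k>0. \<forall>a\<in>bads I. cost I' i a = k * cost I i a) \<and>
           (\<forall>i'\<in>agents I. i' \<noteq> i \<longrightarrow> (\<forall>a\<in>bads I. cost I' i' a = cost I i' a))) \<longrightarrow>
        \<phi> I = \<phi> I')"

definition lower_contraction_consistent :: "('a bads_instance \<Rightarrow> 'a pmf set) \<Rightarrow> bool" where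
  "lower_contraction_consistent \<phi> \<longleftrightarrow>
     (\<forall>I I'. valid_instance I \<and> valid_instance I' \<and> num_agents I = num_agents I' \<and>
        upper_cost_set I \<subseteq> upper_cost_set I' \<longrightarrow>
        cost_vector I' ` \<phi> I' \<inter> cost_set I \<subseteq> cost_vector I ` \<phi> I)"

end

theory Submission
  imports Defs
begin

text \<open>Let \<open>z\<close> be the cost vector of a strictly positive proportionally fair lottery of \<open>I\<close>.
  Proportional fairness says exactly that every cost vector of \<open>I\<close> lies in the half-space
  \<open>(\<Sum>i. w i / (n * z i)) \<ge> 1\<close>. Intersected with the nonnegative orthant, this half-space is the
  upper cost set of the diagonal instance in which agent \<open>i\<close> has a private bad of cost \<open>n * z i\<close>.
  Scale-freeness and weak symmetry force the uniform lottery there, and its cost vector is \<open>z\<close>, so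
  lower contraction consistency carries \<open>z\<close> back to \<open>I\<close>.\<close>

text \<open>\<open>b\<close> names the private bads inside the type of alternatives and
  \<open>d\<close> gives their costs. Both arguments of the cost function are restricted because
  \<open>valid_instance\<close> demands extensional costs.\<close>

definition diagonal_instance :: "nat \<Rightarrow> (nat \<Rightarrow> 'a) \<Rightarrow> (nat \<Rightarrow> real) \<Rightarrow> 'a bads_instance" where
  "diagonal_instance n b d =
     \<lparr>num_agents = n, bads = b ` {1..n},
      cost = (\<lambda>i\<in>{1..n}. \<lambda>a\<in>b ` {1..n}. if a = b i then d i else 0)\<rparr>"

lemma diagonal_instance_simps [simp]:
  "num_agents (diagonal_instance n b d) = n"
  "bads (diagonal_instance n b d) = b ` {1..n}"
  "agents (diagonal_instance n b d) = {1..n}"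
  by (simp_all add: diagonal_instance_def agents_def)

lemma cost_diagonal_instance:
  assumes "i \<in> {1..n}" "a \<in> b ` {1..n}"
  shows "cost (diagonal_instance n b d) i a = (if a = b i then d i else 0)"
  using assms by (simp add: diagonal_instance_def)

lemma lottery_cost_diagonal_instance:
  assumes "i \<in> {1..n}"
  shows "lottery_cost (diagonal_instance n b d) i x = pmf x (b i) * d i"
proof -
  have "lottery_cost (diagonal_instance n b d) i x =
      (\<Sum>a\<in>b ` {1..n}. if a = b i then pmf x (b i) * d i else 0)"
    unfolding lottery_cost_def diagonal_instance_simps
    by (intro sum.cong refl) (use assms in \<open>auto simp: cost_diagonal_instance\<close>)
  also have "\<dots> = pmf x (b i) * d i"
    using assms by (simp add: sum.delta)
  finally show ?thesis .
qed

lemma valid_diagonal_instance: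
  assumes b: "inj_on b {1..n}" and n: "n \<ge> 2" and d: "\<And>i. i \<in> {1..n} \<Longrightarrow> d i > 0"
  shows "valid_instance (diagonal_instance n b d)" (is "valid_instance ?D")
proof -
  have "cost ?D \<in> {1..n} \<rightarrow>\<^sub>E (b ` {1..n} \<rightarrow>\<^sub>E {0..})"
    using d by (auto simp: diagonal_instance_def less_imp_le)
  moreover have "(\<lambda>i\<in>{1..n}. 0) \<notin> cost_set ?D"
  proof
    assume "(\<lambda>i\<in>{1..n}. 0) \<in> cost_set ?D"
    then obtain x where x: "set_pmf x \<subseteq> b ` {1..n}"
      and eq: "(\<lambda>i\<in>{1..n}. 0) = cost_vector ?D x"
      by (auto simp: cost_set_def lotteries_def)
    have "pmf x (b i) = 0" if "i \<in> {1..n}" for i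
    proof -
      have "pmf x (b i) * d i = 0"
        using fun_cong[OF eq, of i] that
        by (simp add: cost_vector_def lottery_cost_diagonal_instance)
      then show ?thesis using d[OF that] by simp
    qed
    then have "(\<Sum>a\<in>b ` {1..n}. pmf x a) = 0" by (intro sum.neutral) auto
    with sum_pmf_eq_1[OF _ x] show False by simp
  qed
  \<comment> \<open>The bad of any other agent is free for agent \<open>i\<close>, and
    \<open>n >= 2\<close> supplies such an agent. With a single agent the only bad would already
    attain the maximum.\<close>
  moreover have "\<exists>a\<in>b ` {1..n}. cost ?D i a < Max (cost ?D i ` b ` {1..n})" if i: "i \<in> {1..n}" for i
  proof -
    obtain j where j: "j \<in> {1..n}" "j \<noteq> i"
      using n i by (metis One_nat_def Suc_1 atLeastAtMost_iff le_trans not_less_eq_eq order_refl nat_le_linear)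
    then have "b j \<noteq> b i" using b i by (meson inj_onD)
    then have "cost ?D i (b j) = 0" using i j by (simp add: cost_diagonal_instance)
    moreover have "cost ?D i (b i) = d i" using i by (simp add: cost_diagonal_instance)
    then have "d i \<le> Max (cost ?D i ` b ` {1..n})"
      using i by (metis Max_ge finite_atLeastAtMost finite_imageI imageI)
    ultimately show ?thesis using d[OF i] j by force
  qed
  ultimately show ?thesis using n by (simp add: valid_instance_def)
qed

lemma identity_diagonal_instance:
  assumes b: "inj_on b {1..n}" and n: "n \<ge> 2"
  shows "identity_instance (diagonal_instance n b (\<lambda>_. 1))"
proof -
  have "\<exists>!a. a \<in> b ` {1..n} \<and> cost (diagonal_instance n b (\<lambda>_. 1)) i a = 1 \<and>
      (\<forall>i'\<in>{1..n}. i' \<noteq> i \<longrightarrow> cost (diagonal_instance n b (\<lambda>_. 1)) i' a = 0)"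
    if i: "i \<in> {1..n}" for i
  proof (rule ex1I[of _ "b i"])
    show "b i \<in> b ` {1..n} \<and> cost (diagonal_instance n b (\<lambda>_. 1)) i (b i) = 1 \<and>
      (\<forall>i'\<in>{1..n}. i' \<noteq> i \<longrightarrow> cost (diagonal_instance n b (\<lambda>_. 1)) i' (b i) = 0)"
      using i inj_onD[OF b] by (auto simp: cost_diagonal_instance)
  next
    fix a assume "a \<in> b ` {1..n} \<and> cost (diagonal_instance n b (\<lambda>_. 1)) i a = 1 \<and>
      (\<forall>i'\<in>{1..n}. i' \<noteq> i \<longrightarrow> cost (diagonal_instance n b (\<lambda>_. 1)) i' a = 0)"
    then show "a = b i"
      using i by (metis cost_diagonal_instance zero_neq_one)
  qed
  then show ?thesis
    using valid_diagonal_instance[OF b n, of "\<lambda>_. 1"] b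
    by (simp add: identity_instance_def card_image)
qed

text \<open>Scale-freeness changes one agent at a time, so the induction runs over the set
  \<open>S\<close> of agents already rescaled, starting from the identity instance, where weak
  symmetry fixes the outcome.\<close>

lemma rule_on_diagonal_instance:
  assumes "weakly_symmetric \<phi>" and sf: "scale_free \<phi>"
    and b: "inj_on b {1..n}" and n: "n \<ge> 2" and d: "\<And>i. i \<in> {1..n} \<Longrightarrow> d i > 0"
  shows "\<phi> (diagonal_instance n b d) = {pmf_of_set (b ` {1..n})}"
proof -
  have scaled: "\<phi> (diagonal_instance n b (\<lambda>i. if i \<in> S then d i else 1)) = {pmf_of_set (b ` {1..n})}"
    if "finite S" "S \<subseteq> {1..n}" for S
    using that
  proof (induction S rule: finite_induct)
    case empty
    have "identity_instance (diagonal_instance n b (\<lambda>_. 1))"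
      using identity_diagonal_instance[OF b n] .
    then show ?case using assms(1) by (simp add: weakly_symmetric_def)
  next
    case (insert k S)
    let ?I = "diagonal_instance n b (\<lambda>i. if i \<in> S then d i else 1)"
    let ?I' = "diagonal_instance n b (\<lambda>i. if i \<in> insert k S then d i else 1)"
    have k: "k \<in> {1..n}" using insert.prems by simp
    have "valid_instance ?I" "valid_instance ?I'"
      using d by (auto intro!: valid_diagonal_instance[OF b n])
    \<comment> \<open>Since \<open>k\<close> is not in \<open>S\<close>, its bad still costs 1 in
      \<open>?I\<close>, so the scaling constant is \<open>d k\<close> itself.\<close>
    moreover have "\<forall>a\<in>bads ?I. cost ?I' k a = d k * cost ?I k a"
      using k insert.hyps by (simp add: cost_diagonal_instance)
    moreover have "\<forall>i'\<in>agents ?I. i' \<noteq> k \<longrightarrow> (\<forall>a\<in>bads ?I. cost ?I' i' a = cost ?I i' a)"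
      by (simp add: cost_diagonal_instance)
    moreover have "num_agents ?I' = num_agents ?I" "bads ?I' = bads ?I" "k \<in> agents ?I" "d k > 0"
      using k d by simp_all
    ultimately have "\<phi> ?I = \<phi> ?I'"
      using sf[unfolded scale_free_def, rule_format, of ?I ?I'] by blast
    then show ?case using insert by simp
  qed
  \<comment> \<open>The two cost parameters may differ outside \<open>{1..n}\<close>, but the
    restriction in the definition makes the records equal.\<close>
  have "diagonal_instance n b (\<lambda>i. if i \<in> {1..n} then d i else 1) = diagonal_instance n b d"
    by (auto simp: diagonal_instance_def fun_eq_iff restrict_def)
  with scaled[of "{1..n}"] show ?thesis by simp
qed

lemma pmf_with_weights_exists:
  fixes f :: "'a \<Rightarrow> real"
  assumes fin: "finite B" and nonneg: "\<And>a. a \<in> B \<Longrightarrow> f a \<ge> 0" and sum: "sum f B = 1"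
  obtains p where "set_pmf p \<subseteq> B" "\<And>a. a \<in> B \<Longrightarrow> pmf p a = f a"
proof -
  \<comment> \<open>\<open>embed_pmf\<close> expects a nonnegative function of total mass 1 on the
    whole type, hence the extension by zero.\<close>
  define g where "g a = (if a \<in> B then f a else 0)" for a
  have g0: "g a \<ge> 0" for a using nonneg by (simp add: g_def)
  have "(\<integral>\<^sup>+a. ennreal (g a) \<partial>count_space UNIV) = (\<Sum>a\<in>B. ennreal (g a))"
    by (rule nn_integral_count_space') (auto simp: g_def fin)
  also have "\<dots> = ennreal (sum g B)" using g0 by (simp add: sum_ennreal)
  also have "sum g B = 1" using sum by (simp add: g_def)
  finally have "pmf (embed_pmf g) a = g a" for a
    using g0 by (simp add: pmf_embed_pmf)
  then show ?thesis
    by (intro that[of "embed_pmf g"]) (auto simp: g_def set_pmf_iff split: if_splits)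
qed

text \<open>Let \<open>s >= 1\<close> be the given sum. The numbers \<open>w i / d i / s\<close> are
  nonnegative and add up to 1; used as probabilities of the bads \<open>b i\<close>, they charge
  agent \<open>i\<close> exactly \<open>w i / s\<close>, which is at most
  \<open>w i\<close>.\<close>

lemma upper_cost_set_diagonal_instanceI:
  assumes b: "inj_on b {1..n}" and d: "\<And>i. i \<in> {1..n} \<Longrightarrow> d i > 0"
    and w: "w \<in> {1..n} \<rightarrow>\<^sub>E {0..}" and sum: "(\<Sum>i\<in>{1..n}. w i / d i) \<ge> 1"
  shows "w \<in> upper_cost_set (diagonal_instance n b d)"
proof -
  define s where "s = (\<Sum>i\<in>{1..n}. w i / d i)"
  \<comment> \<open>A lottery is indexed by bads, so \<open>inv_into\<close> recovers the agent who
    owns a bad.\<close>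
  define f where "f a = (let i = inv_into {1..n} b a in w i / d i / s)" for a
  have f_b: "f (b i) = w i / d i / s" if "i \<in> {1..n}" for i
    using that b by (simp add: f_def)
  have s: "s \<ge> 1" using sum by (simp add: s_def)
  have w0: "w i \<ge> 0" if "i \<in> {1..n}" for i using w that by auto
  have "sum f (b ` {1..n}) = (\<Sum>i\<in>{1..n}. w i / d i / s)"
    using b f_b by (simp add: sum.reindex)
  also have "\<dots> = s / s" by (simp only: s_def sum_divide_distrib)
  also have "\<dots> = 1" using s by simp
  finally have "sum f (b ` {1..n}) = 1" .
  moreover have "f a \<ge> 0" if "a \<in> b ` {1..n}" for a
    using that w0 d s by (auto simp: f_b less_imp_le)
  ultimately obtain p where p: "set_pmf p \<subseteq> b ` {1..n}" "\<And>a. a \<in> b ` {1..n} \<Longrightarrow> pmf p a = f a"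
    using pmf_with_weights_exists[of "b ` {1..n}" f] by blast
  have "cost_vector (diagonal_instance n b d) p i \<le> w i" if i: "i \<in> {1..n}" for i
  proof -
    have "cost_vector (diagonal_instance n b d) p i = w i / s"
      using i p(2)[of "b i"] d[OF i]
      by (simp add: cost_vector_def lottery_cost_diagonal_instance f_b)
    also have "\<dots> \<le> w i" using s w0[OF i] by (simp add: divide_le_eq mult_le_cancel_left1)
    finally show ?thesis .
  qed
  moreover have "cost_vector (diagonal_instance n b d) p \<in> cost_set (diagonal_instance n b d)"
    using p(1) by (simp add: cost_set_def lotteries_def)
  ultimately show ?thesis using w unfolding upper_cost_set_def diagonal_instance_simps by blast
qed

text \<open>Strict positivity rules out the conventions for zero denominators, so the extended real
  sum is a real one. The factor \<open>1 / n\<close> is moved into the denominators, which become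
  the costs of the diagonal instance.\<close>

lemma proportionally_fair_sum_ge:
  assumes "proportionally_fair I x" "strictly_positive I x" "y \<in> lotteries I"
  shows "(\<Sum>i\<in>agents I. lottery_cost I i y / (real (num_agents I) * lottery_cost I i x)) \<ge> 1"
proof -
  have "(\<Sum>i\<in>agents I. cost_ratio (lottery_cost I i y) (lottery_cost I i x)) =
      (\<Sum>i\<in>agents I. ereal (lottery_cost I i y / lottery_cost I i x))"
    using assms(2) by (intro sum.cong refl) (auto simp: cost_ratio_def strictly_positive_def)
  also have "\<dots> = ereal (\<Sum>i\<in>agents I. lottery_cost I i y / lottery_cost I i x)"
    by simp
  finally have eq: "(\<Sum>i\<in>agents I. cost_ratio (lottery_cost I i y) (lottery_cost I i x)) =
      ereal (\<Sum>i\<in>agents I. lottery_cost I i y / lottery_cost I i x)" .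
  have "1 \<le> ereal (1 / real (num_agents I)) *
      (\<Sum>i\<in>agents I. cost_ratio (lottery_cost I i y) (lottery_cost I i x))"
    using assms(1,3) by (simp add: proportionally_fair_def)
  then have "1 \<le> 1 / real (num_agents I) * (\<Sum>i\<in>agents I. lottery_cost I i y / lottery_cost I i x)"
    unfolding eq by simp
  then show ?thesis by (simp add: sum_divide_distrib mult.commute)
qed

theorem theoremD2:
  fixes \<phi> :: "'a bads_instance \<Rightarrow> 'a pmf set"
  assumes "infinite (UNIV :: 'a set)"
    and "allocation_rule \<phi>"
    and "cost_consistent \<phi>"
    and "weakly_symmetric \<phi>"
    and "scale_free \<phi>"
    and "lower_contraction_consistent \<phi>"
  shows "\<forall>I. valid_instance I \<and> num_agents I \<ge> 2 \<longrightarrow>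
           {x \<in> lotteries I. strictly_positive I x \<and> proportionally_fair I x} \<subseteq> \<phi> I"
proof (intro allI impI subsetI)
  fix I :: "'a bads_instance" and x
  assume "valid_instance I \<and> num_agents I \<ge> 2"
    and "x \<in> {x \<in> lotteries I. strictly_positive I x \<and> proportionally_fair I x}"
  then have I: "valid_instance I" and n: "num_agents I \<ge> 2" and x: "x \<in> lotteries I"
    and sp: "strictly_positive I x" and pf: "proportionally_fair I x"
    by auto
  define n where "n = num_agents I"
  have n2: "n \<ge> 2" using n by (simp add: n_def)
  have ag: "agents I = {1..n}" by (simp add: agents_def n_def)
  \<comment> \<open>The infinite type provides distinct names for the \<open>n\<close> private bads,
    however few bads \<open>I\<close> has.\<close>
  obtain b :: "nat \<Rightarrow> 'a" where "inj b"
    using assms(1) infinite_countable_subset by blast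
  then have b: "inj_on b {1..n}" by (rule inj_on_subset) simp
  define d where "d i = real n * lottery_cost I i x" for i
  have d: "d i > 0" if "i \<in> {1..n}" for i
    using sp that n2 by (simp add: d_def strictly_positive_def ag)
  let ?J = "diagonal_instance n b d"
  have J: "valid_instance ?J" using valid_diagonal_instance[OF b n2 d] .
  have upper: "upper_cost_set I \<subseteq> upper_cost_set ?J"
  proof
    fix w assume "w \<in> upper_cost_set I"
    then obtain y where w: "w \<in> {1..n} \<rightarrow>\<^sub>E {0..}" and y: "y \<in> lotteries I"
      and le: "\<And>i. i \<in> {1..n} \<Longrightarrow> lottery_cost I i y \<le> w i"
      by (auto simp: upper_cost_set_def cost_set_def cost_vector_def ag)
    \<comment> \<open>The half-space has positive coefficients \<open>1 / d i\<close>, so it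
      contains \<open>w\<close> along with the cost vector of \<open>y\<close> below it.\<close>
    have "1 \<le> (\<Sum>i\<in>{1..n}. lottery_cost I i y / d i)"
      using proportionally_fair_sum_ge[OF pf sp y] by (simp add: ag d_def n_def)
    also have "\<dots> \<le> (\<Sum>i\<in>{1..n}. w i / d i)"
      using le d by (intro sum_mono divide_right_mono) (auto simp: less_imp_le)
    finally show "w \<in> upper_cost_set ?J"
      using upper_cost_set_diagonal_instanceI[of b n d w] b d w by blast
  qed
  let ?u = "pmf_of_set (b ` {1..n})"
  \<comment> \<open>By injectivity there are exactly \<open>n\<close> bads; the factor
    \<open>n\<close> in \<open>d\<close> cancels the probability \<open>1 / n\<close>.\<close>
  have "pmf ?u (b i) = 1 / real n" if "i \<in> {1..n}" for i
    using that b by (subst pmf_of_set) (auto simp: card_image)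
  then have "cost_vector ?J ?u = cost_vector I x"
    using n2 by (auto simp: cost_vector_def ag lottery_cost_diagonal_instance d_def)
  moreover have "?u \<in> \<phi> ?J"
    using rule_on_diagonal_instance[OF assms(4,5) b n2 d] by simp
  moreover have "cost_vector I x \<in> cost_set I" using x by (simp add: cost_set_def)
  moreover have "cost_vector ?J ` \<phi> ?J \<inter> cost_set I \<subseteq> cost_vector I ` \<phi> I"
    using assms(6) I J upper by (simp add: lower_contraction_consistent_def n_def)
  ultimately have "cost_vector I x \<in> cost_vector I ` \<phi> I" by (metis IntI imageI subsetD)
  \<comment> \<open>Lower contraction consistency yields only some chosen lottery with the cost
    vector of \<open>x\<close>; cost consistency passes from it to \<open>x\<close>.\<close>
  then obtain x' where x': "x' \<in> \<phi> I" and eq: "cost_vector I x = cost_vector I x'" by auto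
  have "lottery_cost I i x = lottery_cost I i x'" if "i \<in> agents I" for i
    using fun_cong[OF eq, of i] that by (simp add: cost_vector_def)
  moreover have "x' \<in> lotteries I" using assms(2) I x' by (auto simp: allocation_rule_def)
  ultimately show "x \<in> \<phi> I"
    using assms(3) I x x' unfolding cost_consistent_def by blast
qed

end
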